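(* The Poisson reduced space $\mathfrak s^*_+/G_R$, identified with the image of the Hilbert map $\sigma$, is the semialgebraic variety of points with coordinates $(\{k_{ij}\}_{1\le i\le j\le3},\delta,r)$ in $\mathbb R^8$ (with $k_{ii}\ge0$) satisfying $$\delta^2=\det(k_{ij})\qquad\text{and}\qquad k_{ij}^2\le k_{ii}k_{jj}\ \text{ for all } i,j,$$ where $(k_{ij})$ is the symmetric $3\times3$ matrix with entries $k_{ij}=k_{ji}$. There are three Casimirs on $\mathfrak s^*_+/G_R$, $$C_1=k_{33}+r^2,$$ $$C_2=(k_{33}+r^2)(k_{11}+k_{22})+2k_{12}(r^2-k_{33})+4k_{13}k_{23}-4r\delta,$$ $$C_3=k_{11}+k_{22}+2k_{12}.$$ The full reduced space $(M_\lambda)_\rho$ is obtained by setting $C_1=1$, $C_2=|\lambda|^2$ and $C_3=|\rho|^2$.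
   Context: $\mathbb H$ is the algebra of real quaternions, identified with $\mathbb R^4$, with inner product $\langle p,q\rangle=\frac12(pq^\dagger+qp^\dagger)$ and norm $|p|^2=\langle p,p\rangle$. $G=S^3\subset\mathbb H$ is the group of unit quaternions, with Lie algebra $\mathfrak g=\mathrm{Im}\,\mathbb H\cong\mathbb R^3$ (with the usual cross product $\times$); spaces are identified with their duals. The phase space of the 2-body problem on the 3-sphere is $$M=\{(g_1,p_1,g_2,p_2)\in\mathbb H^4: g_1,g_2\in G,\ \langle p_1,g_1\rangle=\langle p_2,g_2\rangle=0\}\cong T^*(G\times G)$$ with the canonical symplectic form. Two copies $G_L,G_R$ of $G$ act on $M$: $l\in G_L$ by left multiplication of all entries by $l$, $r\in G_R$ by right multiplication of all entries by $r^{-1}$. Put $R_i=g_i^{-1}p_i$, $L_i=p_ig_i^{-1}$, $g_L=g_1^{-1}g_2$. The momentum maps are $J_L=L_1+L_2=\lambda$ and $J_R=R_1+R_2=\rho$. $\mathfrak s^*_+=\mathfrak g^*\times\mathfrak g^*\times\mathbb H^*$, with elements $(R_1,R_2,g_L)$, is the dual of the Lie algebra of $S=(G\times G)\ltimes\mathbb H$ (action $(a,b)\cdot q=aqb^{-1}$), with Lie–Poisson bracket $$\{f,h\}=\langle R_1,[\nabla_1f,\nabla_1h]\rangle+\langle R_2,[\nabla_2f,\nabla_2h]\rangle+\langle g_L,(\nabla_1f\nabla_3h-\nabla_3h\nabla_2f)-(\nabla_1h\nabla_3f-\nabla_3f\nabla_2h)\rangle ,$$ where $\nabla_i$ denotes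 the gradient with respect to the $i$-th factor and $[a,b]=ab-ba$. The left reduced space $M_\lambda$ (symplectic reduction of $M$ by $G_L$ at $J_L=\lambda$) is identified, via $(g_1,p_1,g_2,p_2)\mapsto(R_1,R_2,g_L)$, with the coadjoint orbit $\{|g_L|^2=1,\ |R_1g_L+g_LR_2|^2=|\lambda|^2\}$ in $\mathfrak s^*_+$. The residual action of $G_R$ on $\mathfrak s^*_+$ is $s\cdot(R_1,R_2,g_L)=(sR_1s^{-1},sR_2s^{-1},sg_Ls^{-1})$ for $s\in G_R$, with momentum map $\rho=R_1+R_2$, and $(M_\lambda)_\rho$ is the (possibly singular) reduced space of $M_\lambda$ by $G_R$ at momentum value $\rho$. Writing $g_L=r+\overline g_L$ with $r\in\mathbb R$ the real part and $\overline g_L\in\mathrm{Im}\,\mathbb H$ the imaginary part, and setting $v_1=R_1$, $v_2=R_2$, $v_3=\overline g_L$, the ring of $G_R$-invariant polynomials on $\mathfrak s^*_+$ is generated by $k_{ij}=\langle v_i,v_j\rangle$ ($i\le j$), $\delta=\langle v_1\times v_2,v_3\rangle$ and $r$. The Hilbert map is $$\sigma\colon\mathfrak s^*_+\to\mathbb R^8,\qquad (v_1,v_2,v_3,r)\mapsto(\{k_{ij}\}_{i\le j},\delta,r).$$ It separates $G_R$-orbits, so $\mathfrak s^*_+/G_R$ is identified with its image, and the Poisson bracket on $\mathfrak s^*_+/G_R$ descends from that on $\mathfrak s^*_+$. *)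

theory Defs
  imports "HOL-Analysis.Analysis"
begin

section \<open>Quaternions\<close>

text \<open>A quaternion is a pair (real part, imaginary part). The library's inner product and norm on
  the product type are those of \<open>\<real>\<^sup>4\<close>; they agree with \<open>(p q\<^sup>\<dagger> + q p\<^sup>\<dagger>) / 2\<close>, see
  \<open>inner_quat\<close> below. The Lie algebra \<open>Im \<H>\<close> is represented by the type \<open>real^3\<close>.\<close>

type_synonym quat = "real \<times> (real^3)"

definition qmul :: "quat \<Rightarrow> quat \<Rightarrow> quat"  (infixl \<open>\<star>\<close> 70) where
  "p \<star> q = (fst p * fst q - snd p \<bullet> snd q,
            fst p *\<^sub>R snd q + fst q *\<^sub>R snd p + cross3 (snd p) (snd q))"

definition qconj :: "quat \<Rightarrow> quat" where
  "qconj q = (fst q, - snd q)"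

definition qinv :: "quat \<Rightarrow> quat" where
  "qinv q = (1 / (norm q)\<^sup>2) *\<^sub>R qconj q"

definition im :: "real^3 \<Rightarrow> quat" where
  "im v = (0, v)"

lemma qmul_assoc: "(p \<star> q) \<star> s = p \<star> (q \<star> s)"
  by (simp add: qmul_def prod_eq_iff vec_eq_iff inner_vec_def sum_3 cross3_simps forall_3)

lemma inner_quat: "(1/2) *\<^sub>R (p \<star> qconj q + q \<star> qconj p) = (p \<bullet> q, 0)"
  by (simp add: qmul_def qconj_def prod_eq_iff vec_eq_iff inner_prod_def inner_vec_def sum_3
      cross3_simps forall_3 diff_divide_distrib)

lemma qmul_qinv: "q \<noteq> 0 \<Longrightarrow> q \<star> qinv q = (1, 0)"
proof -
  assume "q \<noteq> 0"
  moreover have "q \<star> qinv q = (1 / (norm q)\<^sup>2) *\<^sub>R (q \<star> qconj q)"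
    by (simp add: qmul_def qinv_def qconj_def prod_eq_iff vec_eq_iff cross3_simps forall_3)
  moreover have "q \<star> qconj q = ((norm q)\<^sup>2, 0)"
    by (simp add: qmul_def qconj_def prod_eq_iff power2_norm_eq_inner inner_prod_def
        cross_refl)
  ultimately show ?thesis by simp
qed

definition unit_quats :: "quat set" where
  "unit_quats = {q. norm q = 1}"

definition Ad :: "quat \<Rightarrow> real^3 \<Rightarrow> real^3" where
  "Ad s v = snd (s \<star> im v \<star> qinv s)"


section \<open>Orbit spaces\<close>

definition orbit_space :: "'g set \<Rightarrow> ('g \<Rightarrow> 'a \<Rightarrow> 'a) \<Rightarrow> 'a set \<Rightarrow> 'a set set" where
  "orbit_space G act X = (\<lambda>x. (\<lambda>g. act g x) ` G) ` X"

text \<open>The function induced on classes by a function that is constant on each class.\<close>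

definition descend :: "('a \<Rightarrow> 'b) \<Rightarrow> 'a set \<Rightarrow> 'b" where
  "descend f C = the_elem (f ` C)"

definition identified_via :: "('a \<Rightarrow> 'b) \<Rightarrow> 'a set set \<Rightarrow> 'b set \<Rightarrow> bool" where
  "identified_via f Q Y \<longleftrightarrow>
     (\<forall>C\<in>Q. \<forall>x\<in>C. \<forall>x'\<in>C. f x = f x') \<and> bij_betw (descend f) Q Y"


section \<open>The two-body phase space and its reductions\<close>

text \<open>Points are ordered as \<open>(g\<^sub>1, p\<^sub>1, g\<^sub>2, p\<^sub>2)\<close>.\<close>

type_synonym phase_point = "quat \<times> quat \<times> quat \<times> quat"

definition phase_space :: "phase_point set" where
  "phase_space = {(g1, p1, g2, p2).
     g1 \<in> unit_quats \<and> g2 \<in> unit_quats \<and> p1 \<bullet> g1 = 0 \<and> p2 \<bullet> g2 = 0}"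

fun act_left :: "quat \<Rightarrow> phase_point \<Rightarrow> phase_point" where
  "act_left l (g1, p1, g2, p2) = (l \<star> g1, l \<star> p1, l \<star> g2, l \<star> p2)"

fun act_right :: "quat \<Rightarrow> phase_point \<Rightarrow> phase_point" where
  "act_right r (g1, p1, g2, p2) =
     (g1 \<star> qinv r, p1 \<star> qinv r, g2 \<star> qinv r, p2 \<star> qinv r)"

text \<open>On the phase space the quaternions \<open>g\<^sup>-\<^sup>1 p\<close> and \<open>p g\<^sup>-\<^sup>1\<close> are purely imaginary (see
  \<open>momenta_imaginary\<close>), so that taking the imaginary part loses nothing.\<close>

definition Rmom :: "quat \<Rightarrow> quat \<Rightarrow> real^3" where
  "Rmom g p = snd (qinv g \<star> p)"

definition Lmom :: "quat \<Rightarrow> quat \<Rightarrow> real^3" where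
  "Lmom g p = snd (p \<star> qinv g)"

lemma momenta_imaginary:
  assumes "p \<bullet> g = 0"
  shows "qinv g \<star> p = im (Rmom g p)" "p \<star> qinv g = im (Lmom g p)"
  using assms
  by (simp_all add: Rmom_def Lmom_def im_def prod_eq_iff qmul_def qinv_def qconj_def
      inner_prod_def inner_commute mult.commute flip: distrib_left add_divide_distrib)

fun J_left :: "phase_point \<Rightarrow> real^3" where
  "J_left (g1, p1, g2, p2) = Lmom g1 p1 + Lmom g2 p2"

fun J_right :: "phase_point \<Rightarrow> real^3" where
  "J_right (g1, p1, g2, p2) = Rmom g1 p1 + Rmom g2 p2"

text \<open>Elements \<open>(R\<^sub>1, R\<^sub>2, g\<^sub>L)\<close> of the dual of the Lie algebra of \<open>(G \<times> G) \<ltimes> \<H>\<close>.\<close>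

type_synonym sdual = "(real^3) \<times> (real^3) \<times> quat"

fun left_red_map :: "phase_point \<Rightarrow> sdual" where
  "left_red_map (g1, p1, g2, p2) = (Rmom g1 p1, Rmom g2 p2, qinv g1 \<star> g2)"

definition left_reduced :: "real^3 \<Rightarrow> phase_point set set" where
  "left_reduced lam =
     orbit_space {l \<in> unit_quats. Ad l lam = lam} act_left {m \<in> phase_space. J_left m = lam}"

text \<open>The orbit is given by the two Casimir equations that cut it out of the Lie--Poisson space;
  the quaternion inside the second norm equals \<open>g\<^sub>1\<^sup>-\<^sup>1 (L\<^sub>1 + L\<^sub>2) g\<^sub>2\<close> on the
  phase space.\<close>

definition coadjoint_orbit :: "real^3 \<Rightarrow> sdual set" where
  "coadjoint_orbit lam = {(R1, R2, g).
     (norm g)\<^sup>2 = 1 \<and> (norm (im R1 \<star> g + g \<star> im R2))\<^sup>2 = (norm lam)\<^sup>2}"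

text \<open>The reduction of \<open>left_reduced lam\<close> by the right action: the momentum map and the action are
  the ones induced on left classes.\<close>

definition full_reduced :: "real^3 \<Rightarrow> real^3 \<Rightarrow> phase_point set set set" where
  "full_reduced lam rho =
     orbit_space {r \<in> unit_quats. Ad r rho = rho} (\<lambda>r c. act_right r ` c)
       {c \<in> left_reduced lam. descend J_right c = rho}"


section \<open>The Lie--Poisson space and its Poisson reduction\<close>

fun act_s :: "quat \<Rightarrow> sdual \<Rightarrow> sdual" where
  "act_s s (R1, R2, g) = (Ad s R1, Ad s R2, s \<star> g \<star> qinv s)"

primrec C_k :: "nat \<Rightarrow> ('a::euclidean_space \<Rightarrow> real) \<Rightarrow> bool" where
  "C_k 0 f \<longleftrightarrow> continuous_on UNIV f"
| "C_k (Suc k) f \<longleftrightarrow>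
     (\<forall>x. f differentiable (at x)) \<and> (\<forall>v. C_k k (\<lambda>x. frechet_derivative f (at x) v))"

definition smooth :: "('a::euclidean_space \<Rightarrow> real) \<Rightarrow> bool" where
  "smooth f \<longleftrightarrow> (\<forall>k. C_k k f)"

definition grad :: "('a::euclidean_space \<Rightarrow> real) \<Rightarrow> 'a \<Rightarrow> 'a" where
  "grad f x = (THE D. GDERIV f x :> D)"

text \<open>The components of the gradient on the product space are the gradients with respect to the
  three factors.\<close>

definition lie_poisson :: "(sdual \<Rightarrow> real) \<Rightarrow> (sdual \<Rightarrow> real) \<Rightarrow> sdual \<Rightarrow> real" where
  "lie_poisson f h x =
    (case x of (R1, R2, g) \<Rightarrow>
     case grad f x of (f1, f2, f3) \<Rightarrow>
     case grad h x of (h1, h2, h3) \<Rightarrow>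
       im R1 \<bullet> (im f1 \<star> im h1 - im h1 \<star> im f1)
     + im R2 \<bullet> (im f2 \<star> im h2 - im h2 \<star> im f2)
     + g \<bullet> ((im f1 \<star> h3 - h3 \<star> im f2) - (im h1 \<star> f3 - f3 \<star> im h2)))"

text \<open>Coordinates on \<open>\<real>\<^sup>8\<close> in the order
  \<open>(k\<^sub>1\<^sub>1, k\<^sub>1\<^sub>2, k\<^sub>1\<^sub>3, k\<^sub>2\<^sub>2, k\<^sub>2\<^sub>3, k\<^sub>3\<^sub>3, \<delta>, r)\<close>.\<close>

type_synonym coords = "real \<times> real \<times> real \<times> real \<times> real \<times> real \<times> real \<times> real"

fun hilbert_map :: "sdual \<Rightarrow> coords" where
  "hilbert_map (v1, v2, (r, v3)) =
     (v1 \<bullet> v1, v1 \<bullet> v2, v1 \<bullet> v3, v2 \<bullet> v2, v2 \<bullet> v3, v3 \<bullet> v3, cross3 v1 v2 \<bullet> v3, r)"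

fun k_matrix :: "coords \<Rightarrow> real^3^3" where
  "k_matrix (k11, k12, k13, k22, k23, k33, \<delta>, r) =
     vector [vector [k11, k12, k13], vector [k12, k22, k23], vector [k13, k23, k33]]"

fun delta_coord :: "coords \<Rightarrow> real" where
  "delta_coord (k11, k12, k13, k22, k23, k33, \<delta>, r) = \<delta>"

definition reduced_variety :: "coords set" where
  "reduced_variety = {y.
     (\<forall>i. 0 \<le> k_matrix y $ i $ i) \<and>
     (delta_coord y)\<^sup>2 = det (k_matrix y) \<and>
     (\<forall>i j. (k_matrix y $ i $ j)\<^sup>2 \<le> k_matrix y $ i $ i * k_matrix y $ j $ j)}"

text \<open>Smooth functions on the quotient of the Lie--Poisson space are the smooth invariant functions
  upstairs, and the bracket of two of them is their Lie--Poisson bracket. A function \<open>C\<close> of the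
  coordinates on \<open>\<real>\<^sup>8\<close> is regarded as a function on the quotient through its pullback along the
  Hilbert map.\<close>

definition invariant :: "(sdual \<Rightarrow> real) \<Rightarrow> bool" where
  "invariant f \<longleftrightarrow> (\<forall>s\<in>unit_quats. \<forall>x. f (act_s s x) = f x)"

definition casimir_on_quotient :: "(coords \<Rightarrow> real) \<Rightarrow> bool" where
  "casimir_on_quotient C \<longleftrightarrow>
     smooth (C \<circ> hilbert_map) \<and> invariant (C \<circ> hilbert_map) \<and>
     (\<forall>f. smooth f \<and> invariant f \<longrightarrow> (\<forall>x. lie_poisson (C \<circ> hilbert_map) f x = 0))"

fun C1 :: "coords \<Rightarrow> real" where
  "C1 (k11, k12, k13, k22, k23, k33, \<delta>, r) = k33 + r\<^sup>2"

fun C2 :: "coords \<Rightarrow> real" where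
  "C2 (k11, k12, k13, k22, k23, k33, \<delta>, r) =
     (k33 + r\<^sup>2) * (k11 + k22) + 2 * k12 * (r\<^sup>2 - k33) + 4 * k13 * k23 - 4 * r * \<delta>"

fun C3 :: "coords \<Rightarrow> real" where
  "C3 (k11, k12, k13, k22, k23, k33, \<delta>, r) = k11 + k22 + 2 * k12"

end

theory Submission
  imports Defs
begin

text \<open>
  A triple of vectors in \<open>\<real>\<^sup>3\<close> is determined up to rotation by its Gram matrix and its determinant,
  and every rotation needed is conjugation by a unit quaternion: for \<open>|v| = |w|\<close> the quaternion
  \<open>|v|\<^sup>2 - w v\<close> intertwines \<open>v\<close> and \<open>w\<close>. Hence the Hilbert map separates orbits; its image is found
  by a Cholesky factorisation of \<open>(k\<^sub>i\<^sub>j)\<close>.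

  With \<open>g = g\<^sub>L\<close>, the functions \<open>C\<^sub>1\<close> and \<open>C\<^sub>2\<close> pull back to \<open>|g|\<^sup>2\<close> and \<open>|R\<^sub>1 g + g R\<^sub>2|\<^sup>2\<close>, whose
  Hamiltonian vector fields vanish identically. \<open>C\<^sub>3\<close> pulls back to \<open>|R\<^sub>1 + R\<^sub>2|\<^sup>2\<close>, whose Hamiltonian
  vector field is tangent to the \<open>G\<^sub>R\<close>-orbits and so annihilates invariant functions only.

  For the full reduction, \<open>G\<^sub>R\<close> acts transitively on the spheres \<open>|R\<^sub>1 + R\<^sub>2| = |\<rho>|\<close>, and a group element
  matching two points with the same momentum \<open>\<rho>\<close> stabilises \<open>\<rho>\<close>. So the quotient of a fibre of the
  momentum map by the stabiliser is the quotient of the whole sphere level by \<open>G\<^sub>R\<close>.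
\<close>

section \<open>Quaternion algebra and rotations\<close>

lemma qmul_one_left [simp]: "(1, 0) \<star> q = q"
  and qmul_one_right [simp]: "q \<star> (1, 0) = q"
  by (simp_all add: qmul_def cross3_def prod_eq_iff vec_eq_iff forall_3)

text \<open>In finite dimension bilinearity gives boundedness. The interpretation below then
  supplies the distributive laws and the product rule for derivatives.\<close>

lemma bounded_bilinear_qmul: "bounded_bilinear (\<star>)"
  unfolding bilinear_conv_bounded_bilinear[symmetric] bilinear_def
  by (auto intro!: linearI simp: qmul_def prod_eq_iff vec_eq_iff inner_vec_def sum_3 cross3_simps forall_3)

interpretation qmul: bounded_bilinear "(\<star>)"
  by (rule bounded_bilinear_qmul)

lemma bounded_linear_im: "bounded_linear im"
  unfolding linear_conv_bounded_linear[symmetric] by (rule linearI) (simp_all add: im_def)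

lemma qconj_add: "qconj (p + q) = qconj p + qconj q"
  and qconj_scaleR: "qconj (c *\<^sub>R q) = c *\<^sub>R qconj q"
  by (simp_all add: qconj_def)

lemma im_add: "im (v + w) = im v + im w"
  and im_scaleR: "im (c *\<^sub>R v) = c *\<^sub>R im v"
  by (simp_all add: im_def)

lemma qconj_qconj [simp]: "qconj (qconj q) = q"
  by (simp add: qconj_def)

lemma qconj_im: "qconj (im v) = - im v"
  by (simp add: qconj_def im_def)

lemma qconj_qmul: "qconj (p \<star> q) = qconj q \<star> qconj p"
  by (simp add: qmul_def qconj_def prod_eq_iff vec_eq_iff inner_vec_def sum_3 cross3_simps forall_3)

lemma norm_qconj [simp]: "norm (qconj q) = norm q"
  by (simp add: qconj_def norm_prod_def)

lemma qmul_qconj: "q \<star> qconj q = (norm q ^ 2) *\<^sub>R (1, 0)"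
  and qconj_qmul_self: "qconj q \<star> q = (norm q ^ 2) *\<^sub>R (1, 0)"
  by (simp_all add: qmul_def qconj_def prod_eq_iff power2_norm_eq_inner inner_prod_def cross_refl
      Cross3.cross_minus_left Cross3.cross_minus_right)

lemma inner_qmul_left: "(p \<star> q) \<bullet> s = q \<bullet> (qconj p \<star> s)"
  and inner_qmul_right: "(p \<star> q) \<bullet> s = p \<bullet> (s \<star> qconj q)"
  by (simp_all add: qmul_def qconj_def inner_prod_def inner_vec_def sum_3 cross3_simps)

lemma qmul_real_left: "(c, 0) \<star> q = c *\<^sub>R q"
  by (simp add: qmul_def prod_eq_iff)

lemma qmul_real_right: "q \<star> (c, 0) = c *\<^sub>R q"
  by (simp add: qmul_def prod_eq_iff)

lemma norm_qmul: "norm (p \<star> q) = norm p * norm q"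
proof -
  have "(norm (p \<star> q))\<^sup>2 = (norm p * norm q)\<^sup>2"
    by (simp add: power_mult_distrib power2_norm_eq_inner[of "p \<star> q"] inner_qmul_left qconj_qmul_self
        qmul_real_left power2_norm_eq_inner[of q] flip: qmul_assoc)
  then show ?thesis by simp
qed

lemma inner_qmul_qmul_left: "(s \<star> p) \<bullet> (s \<star> q) = (norm s)\<^sup>2 * (p \<bullet> q)"
  by (simp add: inner_qmul_left qconj_qmul_self qmul_real_left flip: qmul_assoc)

lemma inner_qmul_qmul_right: "(p \<star> s) \<bullet> (q \<star> s) = (norm s)\<^sup>2 * (p \<bullet> q)"
  by (simp add: inner_qmul_right qmul_qconj qmul_real_right qmul_assoc)

lemma qinv_qmul: "qinv (p \<star> q) = qinv q \<star> qinv p"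
  by (simp add: qinv_def norm_qmul qconj_qmul qmul.scaleR_left qmul.scaleR_right power_mult_distrib)

lemma qinv_qmul_self: "q \<noteq> 0 \<Longrightarrow> qinv q \<star> q = (1, 0)"
  by (simp add: qinv_def qmul.scaleR_left qconj_qmul_self)

lemma qmul_qinv_cancel: "q \<noteq> 0 \<Longrightarrow> q \<star> (qinv q \<star> p) = p"
  and qinv_qmul_cancel: "q \<noteq> 0 \<Longrightarrow> qinv q \<star> (q \<star> p) = p"
  by (simp_all flip: qmul_assoc add: qmul_qinv qinv_qmul_self)

lemma qinv_qinv [simp]: "qinv (qinv q) = q"
  by (simp add: qinv_def qconj_scaleR power_divide power2_eq_square)

lemma unit_quats_nonzero: "q \<in> unit_quats \<Longrightarrow> q \<noteq> 0"
  by (auto simp: unit_quats_def)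

lemma unit_quats_one: "(1, 0) \<in> unit_quats"
  by (simp add: unit_quats_def)

lemma unit_quats_qmul: "p \<in> unit_quats \<Longrightarrow> q \<in> unit_quats \<Longrightarrow> p \<star> q \<in> unit_quats"
  by (simp add: unit_quats_def norm_qmul)

lemma unit_quats_qinv: "q \<in> unit_quats \<Longrightarrow> qinv q \<in> unit_quats"
  by (simp add: unit_quats_def qinv_def)

section \<open>Imaginary quaternions and the adjoint action\<close>

lemma im_eq_iff [simp]: "im v = im w \<longleftrightarrow> v = w"
  by (simp add: im_def)

lemma snd_im [simp]: "snd (im v) = v"
  by (simp add: im_def)

lemma inner_im [simp]: "im v \<bullet> im w = v \<bullet> w"
  by (simp add: im_def)

lemma norm_im [simp]: "norm (im v) = norm v"
  by (simp add: norm_eq_sqrt_inner)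

text \<open>Writing the cross product as half a commutator makes its invariance under conjugation a
  consequence of associativity.\<close>

lemma im_cross3: "im (cross3 v w) = (1/2) *\<^sub>R (im v \<star> im w - im w \<star> im v)"
  by (simp add: im_def qmul_def inner_commute cross_skew[of w v])

text \<open>A conjugate of an imaginary quaternion has zero real part, so the projection in
  \<open>Ad\<close> loses nothing and identities for \<open>Ad\<close> can be proved in the
  quaternions.\<close>

lemma im_Ad: "im (Ad s v) = s \<star> im v \<star> qinv s"
  by (simp add: Ad_def im_def qmul_def qinv_def qconj_def prod_eq_iff inner_add_left dot_cross_self
      inner_commute algebra_simps)

lemma Ad_one [simp]: "Ad (1, 0) v = v"
  by (simp add: Ad_def qinv_def qconj_def)

lemma Ad_qmul: "Ad (p \<star> q) v = Ad p (Ad q v)"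
  by (simp flip: im_eq_iff add: im_Ad qinv_qmul qmul_assoc)

lemma linear_Ad: "linear (Ad s)"
  unfolding Ad_def
  by (rule linearI) (simp_all add: im_add im_scaleR qmul.add_left qmul.add_right qmul.scaleR_left qmul.scaleR_right)

lemmas Ad_linear = linear_add[OF linear_Ad] linear_diff[OF linear_Ad] linear_cmul[OF linear_Ad]
  linear_0[OF linear_Ad]

lemma Ad_qinv_cancel: "s \<noteq> 0 \<Longrightarrow> Ad (qinv s) (Ad s v) = v"
  by (simp flip: Ad_qmul add: qinv_qmul_self)

lemma norm_Ad: "s \<noteq> 0 \<Longrightarrow> norm (Ad s v) = norm v"
  by (simp flip: norm_im add: im_Ad norm_qmul qinv_def power2_eq_square)

text \<open>Polarisation of \<open>norm_Ad\<close>.\<close>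

lemma inner_Ad:
  assumes "s \<noteq> 0" shows "Ad s v \<bullet> Ad s w = v \<bullet> w"
  using norm_Ad[OF assms, of "v + w"] norm_Ad[OF assms, of v] norm_Ad[OF assms, of w]
  by (simp add: dot_norm Ad_linear)

lemma cross3_Ad: "s \<noteq> 0 \<Longrightarrow> cross3 (Ad s v) (Ad s w) = Ad s (cross3 v w)"
  by (simp flip: im_eq_iff add: im_Ad im_cross3 qmul_assoc qinv_qmul_cancel
      qmul.diff_left qmul.diff_right qmul.scaleR_left qmul.scaleR_right)

section \<open>Rotations carrying given vectors to given vectors\<close>

lemma Ad_scaleR: "c \<noteq> 0 \<Longrightarrow> Ad (c *\<^sub>R s) v = Ad s v"
  by (simp add: Ad_def qinv_def qconj_scaleR qmul.scaleR_left qmul.scaleR_right power_mult_distrib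
      power2_eq_square[of c])

text \<open>Conjugation ignores the scale of \<open>s\<close>, so rotations may be built from
  quaternions that are not normalised.\<close>

lemma ex_unit_Ad:
  assumes "s \<noteq> 0"
  obtains u where "u \<in> unit_quats" "Ad u = Ad s"
proof
  show "(1 / norm s) *\<^sub>R s \<in> unit_quats" using assms by (simp add: unit_quats_def)
  show "Ad ((1 / norm s) *\<^sub>R s) = Ad s" using assms by (simp add: fun_eq_iff Ad_scaleR)
qed

lemma Ad_eqI:
  assumes "s \<noteq> 0" "s \<star> im v = im w \<star> s"
  shows "Ad s v = w"
  using assms by (simp flip: im_eq_iff add: im_Ad qmul_assoc qmul_qinv)

text \<open>The rotation about the axis \<open>a\<close> from \<open>v\<close> to \<open>w\<close>.
  Prescribing the axis is what later allows a second vector to be matched without disturbing the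
  first.\<close>

lemma Ad_transitive_orthogonal:
  assumes "norm v = norm w" "a \<bullet> v = 0" "a \<bullet> w = 0" "a \<noteq> 0"
  obtains s where "s \<in> unit_quats" "Ad s a = a" "Ad s v = w"
proof -
  have "\<exists>s. s \<noteq> 0 \<and> Ad s a = a \<and> Ad s v = w"
  proof (cases "w = - v")
    case True
    \<comment> \<open>Antipodal case: the half turn about \<open>a\<close> is conjugation by
      \<open>a\<close> itself.\<close>
    have "im a \<star> im v = im w \<star> im a" and "im a \<noteq> 0"
      using assms True by (simp_all add: im_def qmul_def inner_commute cross_skew[of a v] Cross3.cross_minus_left prod_eq_iff)
    then show ?thesis by (intro exI[of _ "im a"]) (simp add: Ad_eqI)
  next
    case False
    \<comment> \<open>This is the quaternion |v|^2 - w v. Its real part is half of |v + w|^2, so it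
      vanishes only if w = -v.\<close>
    define s where "s = (v \<bullet> v + v \<bullet> w, cross3 v w)"
    have vw: "v \<bullet> v = w \<bullet> w" using assms(1) by (simp add: norm_eq)
    have "s \<noteq> 0"
    proof
      assume "s = 0"
      then have "v \<bullet> v + v \<bullet> w = 0" by (simp add: s_def prod_eq_iff)
      then have "(v + w) \<bullet> (v + w) = 0" using vw by (simp add: inner_add_left inner_add_right inner_commute)
      with False show False by (simp add: eq_neg_iff_add_eq_0 add.commute)
    qed
    \<comment> \<open>Both \<open>v\<close> and \<open>w\<close> are orthogonal to \<open>a\<close>,
      so the imaginary part of \<open>s\<close> is parallel to \<open>a\<close> and \<open>s\<close>
      commutes with it.\<close>
    have "cross3 (cross3 v w) a = 0"
      using assms by (simp add: cross_skew[of "cross3 v w" a] Lagrange)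
    then have 1: "s \<star> im a = im a \<star> s"
      using cross_skew[of a "cross3 v w"] by (simp add: s_def im_def qmul_def inner_commute)
    have 2: "s \<star> im v = im w \<star> s"
    proof -
      have "cross3 (cross3 v w) v = (v \<bullet> v) *\<^sub>R w - (v \<bullet> w) *\<^sub>R v"
        by (subst cross_skew) (simp add: Lagrange)
      moreover have "cross3 w (cross3 v w) = (v \<bullet> v) *\<^sub>R v - (v \<bullet> w) *\<^sub>R w"
        by (simp add: Lagrange vw inner_commute)
      ultimately show ?thesis
        by (simp add: s_def im_def qmul_def dot_cross_self scaleR_add_left)
    qed
    show ?thesis using Ad_eqI[OF _ 1] Ad_eqI[OF _ 2] \<open>s \<noteq> 0\<close> by (intro exI[of _ s]) simp
  qed
  then obtain s where s: "s \<noteq> 0" "Ad s a = a" "Ad s v = w" by blast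
  obtain u where "u \<in> unit_quats" "Ad u = Ad s" using ex_unit_Ad[OF s(1)] .
  with s that show ?thesis by simp
qed

text \<open>Two vectors in a space of dimension 3 have a common nonzero normal, which serves as the
  axis.\<close>

lemma Ad_transitive:
  assumes "norm v = norm w"
  obtains s where "s \<in> unit_quats" "Ad s v = w"
proof -
  obtain a where "a \<noteq> 0" "a \<bullet> v = 0" "a \<bullet> w = 0"
  proof -
    have "dim {v, w} < DIM(real^3)"
      using dim_le_card'[of "{v,w}"] card_2_iff by (auto simp: card_insert_if split: if_splits)
    then obtain a where "a \<noteq> 0" "\<And>x. x \<in> span {v, w} \<Longrightarrow> orthogonal a x"
      using orthogonal_to_subspace_exists[of "{v,w}"] by blast
    then show ?thesis using that by (simp add: orthogonal_def span_base)
  qed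
  with assms show ?thesis using Ad_transitive_orthogonal that by metis
qed

text \<open>First rotate \<open>v1\<close> to \<open>w1\<close>, then turn about \<open>w1\<close>
  to match the components orthogonal to it.\<close>

lemma Ad_transitive_pair:
  assumes "v1 \<bullet> v1 = w1 \<bullet> w1" "v1 \<bullet> v2 = w1 \<bullet> w2" "v2 \<bullet> v2 = w2 \<bullet> w2"
  obtains s where "s \<in> unit_quats" "Ad s v1 = w1" "Ad s v2 = w2"
proof (cases "w1 = 0")
  case True
  then show ?thesis
    using assms Ad_transitive[of v2 w2] that by (auto simp: norm_eq Ad_linear)
next
  case False
  obtain p where p: "p \<in> unit_quats" "Ad p v1 = w1"
    using assms Ad_transitive[of v1 w1] by (auto simp: norm_eq)
  \<comment> \<open>The coefficient of the projection onto \<open>w1\<close>, common to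
    \<open>w2\<close> and the rotated \<open>v2\<close>.\<close>
  define c where "c = (w1 \<bullet> w2) / (w1 \<bullet> w1)"
  have c: "w1 \<bullet> w2 = c * (w1 \<bullet> w1)" using False by (simp add: c_def)
  have pv: "w1 \<bullet> Ad p v2 = w1 \<bullet> w2" "Ad p v2 \<bullet> Ad p v2 = w2 \<bullet> w2"
    using assms p inner_Ad[OF unit_quats_nonzero[OF p(1)]] by metis+
  obtain q where q: "q \<in> unit_quats" "Ad q w1 = w1" "Ad q (Ad p v2 - c *\<^sub>R w1) = w2 - c *\<^sub>R w1"
  proof (rule Ad_transitive_orthogonal)
    show "norm (Ad p v2 - c *\<^sub>R w1) = norm (w2 - c *\<^sub>R w1)"
      using pv by (simp add: norm_eq inner_diff_left inner_diff_right inner_commute)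
  qed (use False pv c in \<open>auto simp: inner_diff_right\<close>)
  show ?thesis
    using that[of "q \<star> p"] p q by (simp add: unit_quats_qmul Ad_qmul Ad_linear)
qed

text \<open>The vectors \<open>a\<close>, \<open>b\<close> and their cross product form a basis. The
  difference of \<open>x\<close> and \<open>y\<close> is both parallel and orthogonal to the cross
  product, hence zero.\<close>

lemma eq_of_inner_cross3:
  assumes "cross3 a b \<noteq> 0" "x \<bullet> a = y \<bullet> a" "x \<bullet> b = y \<bullet> b" "x \<bullet> cross3 a b = y \<bullet> cross3 a b"
  shows "x = y"
proof -
  let ?n = "cross3 a b" and ?d = "x - y"
  have o: "?d \<bullet> a = 0" "?d \<bullet> b = 0" "?d \<bullet> ?n = 0"
    using assms by (simp_all add: inner_diff_left)
  have "cross3 ?d ?n = 0" using o by (simp add: Lagrange)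
  with o(3) have "?d = 0 \<or> ?n = 0" using norm_and_cross_eq_0 by blast
  with assms(1) show ?thesis by simp
qed

text \<open>Once the first two vectors match, the third is fixed by its inner products with them and
  with their cross product; the last of these is the determinant.\<close>

lemma Ad_transitive_basis:
  assumes "v1 \<bullet> v1 = w1 \<bullet> w1" "v1 \<bullet> v2 = w1 \<bullet> w2" "v1 \<bullet> v3 = w1 \<bullet> w3"
    "v2 \<bullet> v2 = w2 \<bullet> w2" "v2 \<bullet> v3 = w2 \<bullet> w3"
    "cross3 v1 v2 \<bullet> v3 = cross3 w1 w2 \<bullet> w3" "cross3 v1 v2 \<noteq> 0"
  obtains s where "s \<in> unit_quats" "Ad s v1 = w1" "Ad s v2 = w2" "Ad s v3 = w3"
proof -
  obtain s where s: "s \<in> unit_quats" "Ad s v1 = w1" "Ad s v2 = w2"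
    using Ad_transitive_pair assms by metis
  note nz = unit_quats_nonzero[OF s(1)]
  have cr: "cross3 w1 w2 = Ad s (cross3 v1 v2)" using cross3_Ad[OF nz, of v1 v2] s by simp
  have "cross3 w1 w2 \<noteq> 0" using norm_Ad[OF nz, of "cross3 v1 v2"] assms(7) by (auto simp: cr)
  moreover have "Ad s v3 \<bullet> w1 = w3 \<bullet> w1" "Ad s v3 \<bullet> w2 = w3 \<bullet> w2"
    "Ad s v3 \<bullet> cross3 w1 w2 = w3 \<bullet> cross3 w1 w2"
    using inner_Ad[OF nz] assms s cr by (metis inner_commute)+
  ultimately have "Ad s v3 = w3" by (rule eq_of_inner_cross3)
  with s that show ?thesis by blast
qed

lemma cross3_eq_0_multiple:
  assumes "cross3 a b = 0" "a \<noteq> 0"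
  obtains c where "b = c *\<^sub>R a"
  using assms by (auto simp: cross_eq_0 collinear_lemma)

text \<open>The squared norm of \<open>w - c *\<^sub>R u\<close> expands to zero. This carries a
  linear dependence from one triple to another with the same Gram matrix.\<close>

lemma eq_multiple_of_inner:
  fixes w :: "'a::real_inner"
  assumes "w \<bullet> w = c * (u \<bullet> w)" "u \<bullet> w = c * (u \<bullet> u)"
  shows "w = c *\<^sub>R u"
proof -
  have "(w - c *\<^sub>R u) \<bullet> (w - c *\<^sub>R u) = 0"
    using assms by (simp add: inner_diff_left inner_diff_right inner_commute algebra_simps)
  then show ?thesis by simp
qed

text \<open>Either \<open>v1\<close> vanishes and only a pair remains, or \<open>v1\<close> is
  independent of one of the others and the basis case applies, or all three vectors lie on the line
  of \<open>v1\<close>.\<close>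

lemma Ad_transitive_triple:
  assumes "v1 \<bullet> v1 = w1 \<bullet> w1" "v1 \<bullet> v2 = w1 \<bullet> w2" "v1 \<bullet> v3 = w1 \<bullet> w3"
    "v2 \<bullet> v2 = w2 \<bullet> w2" "v2 \<bullet> v3 = w2 \<bullet> w3" "v3 \<bullet> v3 = w3 \<bullet> w3"
    "cross3 v1 v2 \<bullet> v3 = cross3 w1 w2 \<bullet> w3"
  obtains s where "s \<in> unit_quats" "Ad s v1 = w1" "Ad s v2 = w2" "Ad s v3 = w3"
proof (cases "v1 = 0")
  case True
  then have "w1 = 0" using assms(1) by simp
  with True show ?thesis using Ad_transitive_pair[OF assms(4-6)] that by (auto simp: Ad_linear)
next
  case nz: False
  consider "cross3 v1 v2 \<noteq> 0" | "cross3 v1 v3 \<noteq> 0" | "cross3 v1 v2 = 0" "cross3 v1 v3 = 0" by blast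
  then show ?thesis
  proof cases
    case 1
    then show ?thesis using Ad_transitive_basis[OF assms(1-5,7)] that by blast
  next
    case 2
    \<comment> \<open>Exchanging the roles of the second and third vectors flips the sign of both
      determinants.\<close>
    have swap: "cross3 a c \<bullet> b = - (cross3 a b \<bullet> c)" for a b c :: "real^3"
      by (simp add: inner_vec_def sum_3 cross3_simps)
    have "cross3 v1 v3 \<bullet> v2 = cross3 w1 w3 \<bullet> w2" "v3 \<bullet> v2 = w3 \<bullet> w2"
      using assms by (simp_all only: swap[of _ v3 v2] swap[of _ w3 w2] inner_commute[of v3 v2] inner_commute[of w3 w2])
    then show ?thesis
      using Ad_transitive_basis[OF assms(1,3,2,6) _ _ 2] that by blast
  next
    case 3
    obtain c where c: "v2 = c *\<^sub>R v1" using cross3_eq_0_multiple[OF 3(1) nz] .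
    obtain d where d: "v3 = d *\<^sub>R v1" using cross3_eq_0_multiple[OF 3(2) nz] .
    obtain s where s: "s \<in> unit_quats" "Ad s v1 = w1"
      using assms Ad_transitive[of v1 w1] by (auto simp: norm_eq)
    have "w2 = c *\<^sub>R w1" "w3 = d *\<^sub>R w1"
      using assms by (auto intro!: eq_multiple_of_inner simp: c d)
    with s show ?thesis using that by (simp add: c d Ad_linear)
  qed
qed


section \<open>Orbit spaces and the Hilbert map\<close>

lemma orbit_space_classE:
  assumes "C \<in> orbit_space G act X"
  obtains x where "x \<in> X" "C = (\<lambda>g. act g x) ` G"
  using assms by (auto simp: orbit_space_def)

lemma descend_eq:
  assumes "C \<noteq> {}" "\<And>x. x \<in> C \<Longrightarrow> f x = y"
  shows "descend f C = y"
proof -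
  have "f ` C = {y}" using assms by auto
  then show ?thesis by (simp add: descend_def)
qed

text \<open>Common criterion for the three quotients. Nonemptiness of \<open>G\<close> makes every
  class nonempty, so that \<open>descend\<close> returns the value of \<open>f\<close>
  there.\<close>

lemma identified_via_orbit_space:
  assumes ne: "G \<noteq> {}"
    and inv: "\<And>g x. g \<in> G \<Longrightarrow> x \<in> X \<Longrightarrow> f (act g x) = f x"
    and sep: "\<And>x y. x \<in> X \<Longrightarrow> y \<in> X \<Longrightarrow> f x = f y \<Longrightarrow> (\<lambda>g. act g x) ` G = (\<lambda>g. act g y) ` G"
    and img: "f ` X = Y"
  shows "identified_via f (orbit_space G act X) Y"
proof -
  have desc: "descend f ((\<lambda>g. act g x) ` G) = f x" if "x \<in> X" for x
    using ne inv[OF _ that] by (intro descend_eq) (simp, blast)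
  have "bij_betw (descend f) (orbit_space G act X) Y"
    unfolding bij_betw_def
  proof
    show "inj_on (descend f) (orbit_space G act X)"
    proof (rule inj_onI)
      fix C D assume C: "C \<in> orbit_space G act X" and D: "D \<in> orbit_space G act X"
        and eq: "descend f C = descend f D"
      obtain x where x: "x \<in> X" "C = (\<lambda>g. act g x) ` G" using C by (rule orbit_space_classE)
      obtain y where y: "y \<in> X" "D = (\<lambda>g. act g y) ` G" using D by (rule orbit_space_classE)
      show "C = D" using sep[OF x(1) y(1)] eq by (simp add: x y desc)
    qed
    show "descend f ` orbit_space G act X = Y"
      by (simp add: orbit_space_def image_image desc flip: img cong: image_cong)
  qed
  moreover have "f x = f x'" if "C \<in> orbit_space G act X" "x \<in> C" "x' \<in> C" for C x x'
    using that inv by (auto elim!: orbit_space_classE)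
  ultimately show ?thesis unfolding identified_via_def by blast
qed

text \<open>The isotropy group of a momentum value. Since \<open>stab 0\<close> is the whole group,
  quotients by the full group and by a stabiliser are treated alike.\<close>

definition stab :: "real^3 \<Rightarrow> quat set" where
  "stab v = {s \<in> unit_quats. Ad s v = v}"

lemma stab_qmul: "p \<in> stab v \<Longrightarrow> q \<in> stab v \<Longrightarrow> p \<star> q \<in> stab v"
  by (simp add: stab_def unit_quats_qmul Ad_qmul)

lemma stab_qinv: "p \<in> stab v \<Longrightarrow> qinv p \<in> stab v"
  using Ad_qinv_cancel[OF unit_quats_nonzero, of p v] by (simp add: stab_def unit_quats_qinv)

lemma one_in_stab: "(1, 0) \<in> stab v"
  by (simp add: stab_def unit_quats_one)

lemma stab_zero: "stab 0 = unit_quats"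
  by (simp add: stab_def Ad_linear)

text \<open>Right translation by \<open>s\<close> or its inverse reparametrises one orbit as the
  other.\<close>

lemma stab_orbit_eq:
  assumes act: "\<And>p q x. act (p \<star> q) x = act p (act q x)" and s: "s \<in> stab v" and y: "y = act s x"
  shows "(\<lambda>g. act g x) ` stab v = (\<lambda>g. act g y) ` stab v"
proof
  have "act g x = act (g \<star> qinv s) y" for g
    using s by (simp flip: act add: y qmul_assoc qinv_qmul_self stab_def unit_quats_nonzero)
  then show "(\<lambda>g. act g x) ` stab v \<subseteq> (\<lambda>g. act g y) ` stab v"
    using stab_qmul[OF _ stab_qinv[OF s]] by blast
  show "(\<lambda>g. act g y) ` stab v \<subseteq> (\<lambda>g. act g x) ` stab v"
    using stab_qmul[OF _ s] by (auto simp: y simp flip: act)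
qed

section \<open>The group actions and the invariants\<close>

lemma act_s_qmul: "act_s (p \<star> q) x = act_s p (act_s q x)"
  by (cases x) (simp add: Ad_qmul qinv_qmul qmul_assoc)

lemma act_left_qmul: "act_left (p \<star> q) x = act_left p (act_left q x)"
  by (cases x) (simp add: qmul_assoc)

lemma act_right_qmul: "act_right (p \<star> q) x = act_right p (act_right q x)"
  by (cases x) (simp add: qinv_qmul qmul_assoc)

lemma act_left_right: "act_left l (act_right r x) = act_right r (act_left l x)"
  by (cases x) (simp add: qmul_assoc)

text \<open>Real quaternions are central, so conjugation fixes the real part and rotates the
  imaginary part; the third factor thus contributes one scalar and one vector.\<close>

lemma qmul_real_conj:
  assumes "s \<noteq> 0"
  shows "s \<star> q \<star> qinv s = (fst q, Ad s (snd q))"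
proof -
  have "q = (fst q, 0) + im (snd q)" by (simp add: im_def)
  then have "s \<star> q \<star> qinv s = s \<star> (fst q, 0) \<star> qinv s + s \<star> im (snd q) \<star> qinv s"
    by (simp only: flip: qmul.add_left qmul.add_right)
  also have "s \<star> (fst q, 0) \<star> qinv s = (fst q, 0)"
    using assms by (simp add: qmul_real_right qmul.scaleR_left qmul_qinv)
  finally show ?thesis
    by (simp flip: im_Ad) (simp add: im_def)
qed

lemma hilbert_map_act_s: "s \<noteq> 0 \<Longrightarrow> hilbert_map (act_s s x) = hilbert_map x"
  by (cases x rule: hilbert_map.cases) (simp add: qmul_real_conj inner_Ad cross3_Ad)

lemma hilbert_map_separates:
  assumes "hilbert_map x = hilbert_map y"
  obtains s where "s \<in> unit_quats" "y = act_s s x"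
proof -
  obtain v1 v2 v3 r where x: "x = (v1, v2, (r, v3))" by (cases x rule: hilbert_map.cases)
  obtain w1 w2 w3 t where y: "y = (w1, w2, (t, w3))" by (cases y rule: hilbert_map.cases)
  obtain s where "s \<in> unit_quats" "Ad s v1 = w1" "Ad s v2 = w2" "Ad s v3 = w3"
    using assms Ad_transitive_triple[of v1 w1 v2 w2 v3 w3] unfolding x y hilbert_map.simps prod.inject by blast
  with assms that show ?thesis by (simp add: x y qmul_real_conj unit_quats_nonzero)
qed

lemma identified_via_hilbert_map:
  "identified_via hilbert_map (orbit_space unit_quats act_s UNIV) (range hilbert_map)"
proof (rule identified_via_orbit_space)
  fix x y assume "hilbert_map x = hilbert_map y"
  then obtain s where "s \<in> unit_quats" "y = act_s s x" by (rule hilbert_map_separates)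
  then show "(\<lambda>g. act_s g x) ` unit_quats = (\<lambda>g. act_s g y) ` unit_quats"
    by (intro stab_orbit_eq[where act = act_s and v = 0, unfolded stab_zero, OF act_s_qmul])
qed (use unit_quats_one hilbert_map_act_s unit_quats_nonzero in auto)


section \<open>Image of the Hilbert map\<close>

lemma reduced_variety_iff:
  "(k11, k12, k13, k22, k23, k33, d, r) \<in> reduced_variety \<longleftrightarrow>
     0 \<le> k11 \<and> 0 \<le> k22 \<and> 0 \<le> k33 \<and>
     d\<^sup>2 = k11 * k22 * k33 + 2 * k12 * k13 * k23 - k11 * k23\<^sup>2 - k22 * k13\<^sup>2 - k33 * k12\<^sup>2 \<and>
     k12\<^sup>2 \<le> k11 * k22 \<and> k13\<^sup>2 \<le> k11 * k33 \<and> k23\<^sup>2 \<le> k22 * k33"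
  by (auto simp: reduced_variety_def forall_3 det_3 power2_eq_square mult.commute algebra_simps)

lemma hilbert_map_in_reduced_variety: "hilbert_map x \<in> reduced_variety"
proof -
  obtain v1 v2 v3 r where x: "x = (v1, v2, (r, v3))" by (cases x rule: hilbert_map.cases)
  \<comment> \<open>The Gram determinant is the square of the triple product.\<close>
  have "(cross3 v1 v2 \<bullet> v3)\<^sup>2 =
    (v1 \<bullet> v1) * (v2 \<bullet> v2) * (v3 \<bullet> v3) + 2 * (v1 \<bullet> v2) * (v1 \<bullet> v3) * (v2 \<bullet> v3)
      - (v1 \<bullet> v1) * (v2 \<bullet> v3)\<^sup>2 - (v2 \<bullet> v2) * (v1 \<bullet> v3)\<^sup>2 - (v3 \<bullet> v3) * (v1 \<bullet> v2)\<^sup>2"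
    by (simp add: cross3_simps power2_eq_square)
  then show ?thesis
    unfolding x hilbert_map.simps reduced_variety_iff by (simp add: Cauchy_Schwarz_ineq)
qed

text \<open>The vectors are sought in triangular form: the first on the first axis, the second in
  the plane of the first two axes. The 2 by 2 minor inequalities yield the square roots, the
  determinant equation the last coordinate.\<close>

lemma reduced_variety_subset:
  assumes "y \<in> reduced_variety"
  shows "y \<in> range hilbert_map"
proof -
  obtain k11 k12 k13 k22 k23 k33 d r where y: "y = (k11, k12, k13, k22, k23, k33, d, r)"
    by (cases y rule: delta_coord.cases)
  have k: "0 \<le> k11" "0 \<le> k22" "0 \<le> k33" "k12\<^sup>2 \<le> k11 * k22" "k13\<^sup>2 \<le> k11 * k33" "k23\<^sup>2 \<le> k22 * k33"
    and det: "d\<^sup>2 = k11 * k22 * k33 + 2 * k12 * k13 * k23 - k11 * k23\<^sup>2 - k22 * k13\<^sup>2 - k33 * k12\<^sup>2"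
    using assms unfolding y reduced_variety_iff by auto
  have "\<exists>v1 v2 v3. v1 \<bullet> v1 = k11 \<and> v1 \<bullet> v2 = k12 \<and> v1 \<bullet> v3 = k13 \<and> v2 \<bullet> v2 = k22 \<and>
    v2 \<bullet> v3 = k23 \<and> v3 \<bullet> v3 = k33 \<and> cross3 v1 v2 \<bullet> v3 = d"
  proof (cases "k11 = 0")
    case k11: True
    \<comment> \<open>A zero diagonal entry forces its row to vanish, and with it the
      determinant.\<close>
    then have "k12 = 0" "k13 = 0" "d = 0" using k det by auto
    show ?thesis
    proof (cases "k22 = 0")
      case True
      then have "k23 = 0" using k by auto
      then show ?thesis
        using k11 True \<open>k12 = 0\<close> \<open>k13 = 0\<close> \<open>d = 0\<close> k
        by (intro exI[of _ 0] exI[of _ "vector [sqrt k33, 0, 0]"]) (simp add: inner_vec_def sum_3)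
    next
      case False
      define a where "a = sqrt k22"
      have a: "a > 0" "k22 = a\<^sup>2" using False k by (simp_all add: a_def)
      define b where "b = sqrt (k33 - (k23 / a)\<^sup>2)"
      have b: "b\<^sup>2 = k33 - (k23 / a)\<^sup>2"
        using k(6) a by (simp add: b_def field_simps)
      show ?thesis
        using k11 \<open>k12 = 0\<close> \<open>k13 = 0\<close> \<open>d = 0\<close> a b
        by (intro exI[of _ 0] exI[of _ "vector [a, 0, 0]"] exI[of _ "vector [k23 / a, b, 0]"])
          (simp add: inner_vec_def sum_3 flip: power2_eq_square)
    qed
  next
    case False
    define a where "a = sqrt k11"
    have a: "a > 0" "k11 = a\<^sup>2" using False k by (simp_all add: a_def)
    \<comment> \<open>The first coordinates of the second and third vectors.\<close>
    define m n where "m = k12 / a" and "n = k13 / a"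
    have mn: "k12 = a * m" "k13 = a * n" using a by (simp_all add: m_def n_def)
    have "m\<^sup>2 \<le> k22" "n\<^sup>2 \<le> k33" using k(4,5) a by (simp_all add: mn power_mult_distrib)
    define b where "b = sqrt (k22 - m\<^sup>2)"
    have b: "k22 = m\<^sup>2 + b\<^sup>2" using \<open>m\<^sup>2 \<le> k22\<close> by (simp add: b_def)
    \<comment> \<open>The determinant is the pivot times the determinant of the 2 by 2 Schur
      complement.\<close>
    have "d\<^sup>2 = a\<^sup>2 * (b\<^sup>2 * (k33 - n\<^sup>2) - (k23 - m * n)\<^sup>2)"
      unfolding det a(2) mn b by (simp add: power2_eq_square algebra_simps)
    then have d: "(d / a)\<^sup>2 = b\<^sup>2 * (k33 - n\<^sup>2) - (k23 - m * n)\<^sup>2"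
      using a(1) by (simp add: power_divide)
    show ?thesis
    proof (cases "b = 0")
      case True
      \<comment> \<open>With a zero second pivot the determinant equation is a vanishing sum of two
        squares.\<close>
      with d have "(d / a)\<^sup>2 + (k23 - m * n)\<^sup>2 = 0" by simp
      then have "d = 0" "k23 = m * n" using a(1) by (simp_all add: sum_power2_eq_zero_iff)
      then show ?thesis
        using a mn b True \<open>n\<^sup>2 \<le> k33\<close>
        by (intro exI[of _ "vector [a, 0, 0]"] exI[of _ "vector [m, 0, 0]"] exI[of _ "vector [n, sqrt (k33 - n\<^sup>2), 0]"])
          (simp add: inner_vec_def sum_3 cross3_def flip: power2_eq_square)
    next
      case False
      \<comment> \<open>The remaining coordinates of the third vector; \<open>f\<close> carries the
        sign of \<open>d\<close>.\<close>
      define e f where "e = (k23 - m * n) / b" and "f = d / (a * b)"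
      have ef: "k23 = m * n + b * e" "d = a * b * f" using False a by (simp_all add: e_def f_def)
      have "b\<^sup>2 * f\<^sup>2 = b\<^sup>2 * (k33 - n\<^sup>2 - e\<^sup>2)"
        using d a(1) by (simp add: ef power2_eq_square algebra_simps)
      then have "k33 = n\<^sup>2 + e\<^sup>2 + f\<^sup>2" using False by simp
      with a(2) mn b ef show ?thesis
        by (intro exI[of _ "vector [a, 0, 0]"] exI[of _ "vector [m, b, 0]"] exI[of _ "vector [n, e, f]"])
          (simp add: inner_vec_def sum_3 cross3_def power2_eq_square)
    qed
  qed
  then obtain v1 v2 v3 where "hilbert_map (v1, v2, (r, v3)) = y" unfolding y hilbert_map.simps by blast
  then show ?thesis by blast
qed

lemma range_hilbert_map: "range hilbert_map = reduced_variety"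
  using hilbert_map_in_reduced_variety reduced_variety_subset by blast


section \<open>Reduction of the two-body phase space\<close>

lemma left_red_map_act_left: "l \<noteq> 0 \<Longrightarrow> left_red_map (act_left l m) = left_red_map m"
  by (cases m) (simp add: Rmom_def qinv_qmul qmul_assoc qinv_qmul_cancel)

lemma left_red_map_act_right:
  assumes "r \<in> unit_quats"
  shows "left_red_map (act_right r m) = act_s r (left_red_map m)"
proof -
  have "Rmom (g \<star> qinv r) (p \<star> qinv r) = Ad r (Rmom g p)" for g p
    using qmul_real_conj[OF unit_quats_nonzero[OF assms], of "qinv g \<star> p"]
    by (simp add: Rmom_def qinv_qmul qmul_assoc)
  then show ?thesis by (cases m) (simp add: qinv_qmul qmul_assoc)
qed

lemma J_right_eq: "J_right m = fst (left_red_map m) + fst (snd (left_red_map m))"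
  by (cases m) simp

lemma phase_space_act_left:
  assumes "l \<in> unit_quats" "m \<in> phase_space"
  shows "act_left l m \<in> phase_space"
proof -
  obtain g1 p1 g2 p2 where "m = (g1, p1, g2, p2)" by (rule prod_cases4)
  with assms show ?thesis
    by (simp add: phase_space_def unit_quats_qmul inner_qmul_qmul_left)
qed

lemma phase_space_act_right:
  assumes "r \<in> unit_quats" "m \<in> phase_space"
  shows "act_right r m \<in> phase_space"
proof -
  obtain g1 p1 g2 p2 where "m = (g1, p1, g2, p2)" by (rule prod_cases4)
  with assms show ?thesis
    by (simp add: phase_space_def unit_quats_qmul unit_quats_qinv inner_qmul_qmul_right)
qed

lemma J_left_act_left:
  assumes "l \<in> unit_quats"
  shows "J_left (act_left l m) = Ad l (J_left m)"
proof -
  have "Lmom (l \<star> g) (l \<star> p) = Ad l (Lmom g p)" for g p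
    using qmul_real_conj[OF unit_quats_nonzero[OF assms], of "p \<star> qinv g"]
    by (simp add: Lmom_def qinv_qmul qmul_assoc)
  then show ?thesis by (cases m) (simp add: Ad_linear)
qed

lemma J_left_act_right: "r \<in> unit_quats \<Longrightarrow> J_left (act_right r m) = J_left m"
  by (cases m) (simp add: Lmom_def qinv_qmul qmul_assoc qinv_qmul_cancel unit_quats_nonzero)

text \<open>Reconstructs a phase point from its reduced data and a chosen first position
  \<open>g1\<close>, using g2 = g1 g and p_i = g_i R_i.\<close>

definition body :: "quat \<Rightarrow> sdual \<Rightarrow> phase_point" where
  "body g1 = (\<lambda>(R1, R2, g). (g1, g1 \<star> im R1, g1 \<star> g, g1 \<star> g \<star> im R2))"

lemma phase_space_eq_body:
  assumes "m \<in> phase_space"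
  shows "m = body (fst m) (left_red_map m)"
  using assms
  by (cases m) (auto simp: body_def phase_space_def unit_quats_nonzero qmul_qinv_cancel
      simp flip: momenta_imaginary)

lemma body_in_phase_space:
  assumes "g1 \<in> unit_quats" "g \<in> unit_quats"
  shows "body g1 (R1, R2, g) \<in> phase_space"
proof -
  have "(h \<star> im R) \<bullet> h = 0" for h R
    by (simp add: inner_qmul_left qconj_qmul_self) (simp add: im_def)
  then show ?thesis using assms by (simp add: body_def phase_space_def unit_quats_qmul)
qed

lemma left_red_map_body:
  assumes "g1 \<in> unit_quats" "g \<in> unit_quats"
  shows "left_red_map (body g1 (R1, R2, g)) = (R1, R2, g)"
proof -
  have "Rmom h (h \<star> im R) = R" if "h \<in> unit_quats" for h R
    using that by (simp add: Rmom_def qinv_qmul_cancel unit_quats_nonzero)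
  then show ?thesis
    using assms unit_quats_qmul[OF assms] by (simp add: body_def qinv_qmul_cancel unit_quats_nonzero)
qed

text \<open>Each L_i is g_i R_i conjugated back by the inverse of g_i. Pulling out \<open>g1\<close>
  on the left and the inverse of g2 on the right leaves the quaternion of the orbit equation, so for
  unit \<open>g1\<close> and \<open>g\<close> its norm is that of the left momentum.\<close>

lemma im_J_left_body:
  assumes "g \<in> unit_quats"
  shows "im (J_left (body g1 (R1, R2, g))) = g1 \<star> (im R1 \<star> g + g \<star> im R2) \<star> qinv (g1 \<star> g)"
proof -
  have "im (Lmom h (h \<star> im R)) = h \<star> im R \<star> qinv h" for h R
    by (simp add: Lmom_def flip: im_Ad)
  from this[of g1 R1] this[of "g1 \<star> g" R2] show ?thesis
    using unit_quats_nonzero[OF assms]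
    by (simp add: body_def im_add qmul.add_left qmul.add_right qinv_qmul qmul_assoc qmul_qinv_cancel)
qed

lemma norm_J_left_body:
  assumes "g1 \<in> unit_quats" "g \<in> unit_quats"
  shows "norm (J_left (body g1 (R1, R2, g))) = norm (im R1 \<star> g + g \<star> im R2)"
proof -
  have "norm (J_left (body g1 (R1, R2, g))) = norm (im (J_left (body g1 (R1, R2, g))))" by simp
  also have "\<dots> = norm (im R1 \<star> g + g \<star> im R2)"
    unfolding im_J_left_body[OF assms(2)]
    using assms unit_quats_qinv[OF unit_quats_qmul[OF assms]] by (simp add: norm_qmul unit_quats_def)
  finally show ?thesis .
qed

section \<open>The left reduced space as a coadjoint orbit\<close>

lemma coadjoint_orbit_iff:
  "(R1, R2, g) \<in> coadjoint_orbit lam \<longleftrightarrow>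
     g \<in> unit_quats \<and> norm (im R1 \<star> g + g \<star> im R2) = norm lam"
  using power2_eq_iff_nonneg[of "norm g" 1] by (simp add: coadjoint_orbit_def unit_quats_def)

lemma left_red_map_image:
  "left_red_map ` {m \<in> phase_space. J_left m = lam} = coadjoint_orbit lam"
proof (intro subset_antisym subsetI)
  fix x assume "x \<in> left_red_map ` {m \<in> phase_space. J_left m = lam}"
  then obtain m where m: "m \<in> phase_space" "J_left m = lam" "x = left_red_map m" by blast
  obtain g1 p1 g2 p2 where mm: "m = (g1, p1, g2, p2)" by (rule prod_cases4)
  have g: "g1 \<in> unit_quats" "qinv g1 \<star> g2 \<in> unit_quats"
    using m(1) by (simp_all add: mm phase_space_def unit_quats_qmul unit_quats_qinv)
  show "x \<in> coadjoint_orbit lam"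
    using norm_J_left_body[OF g, of "Rmom g1 p1" "Rmom g2 p2", symmetric] phase_space_eq_body[OF m(1)] g(2) m(2)
    unfolding m(3) mm left_red_map.simps fst_conv coadjoint_orbit_iff by simp
next
  fix x assume x: "x \<in> coadjoint_orbit lam"
  obtain R1 R2 g where xx: "x = (R1, R2, g)" by (rule prod_cases3)
  have g: "g \<in> unit_quats" and n: "norm (im R1 \<star> g + g \<star> im R2) = norm lam"
    using x by (simp_all only: xx coadjoint_orbit_iff)
  define m where "m = body (1, 0) x"
  have m: "m \<in> phase_space" "left_red_map m = x" "norm (J_left m) = norm lam"
    unfolding m_def xx
    using n body_in_phase_space left_red_map_body norm_J_left_body unit_quats_one g by simp_all
  \<comment> \<open>The reconstructed point has left momentum of the right length only; a left
    translation turns it into \<open>lam\<close> and keeps the reduced data.\<close>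
  obtain l where l: "l \<in> unit_quats" "Ad l (J_left m) = lam" using m(3) by (rule Ad_transitive)
  show "x \<in> left_red_map ` {m \<in> phase_space. J_left m = lam}"
  proof (rule image_eqI)
    show "x = left_red_map (act_left l m)"
      using m l by (simp add: left_red_map_act_left unit_quats_nonzero)
    show "act_left l m \<in> {m \<in> phase_space. J_left m = lam}"
      using m l by (simp add: phase_space_act_left J_left_act_left)
  qed
qed

text \<open>Both points are reconstructed from the same reduced data, so they differ by the left
  translation relating their first positions.\<close>

lemma left_red_map_separates:
  assumes "m \<in> phase_space" "n \<in> phase_space" "left_red_map m = left_red_map n"
  obtains l where "l \<in> unit_quats" "n = act_left l m"
proof
  have u: "fst m \<in> unit_quats" "fst n \<in> unit_quats" using assms by (auto simp: phase_space_def)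
  show "fst n \<star> qinv (fst m) \<in> unit_quats" using u by (simp add: unit_quats_qmul unit_quats_qinv)
  have "act_left l (body g x) = body (l \<star> g) x" for l g x
    by (simp add: body_def qmul_assoc split: prod.split)
  then have "act_left (fst n \<star> qinv (fst m)) m = body (fst n \<star> qinv (fst m) \<star> fst m) (left_red_map m)"
    using phase_space_eq_body[OF assms(1)] by metis
  also have "\<dots> = n"
    using u phase_space_eq_body[OF assms(2)] by (simp add: assms(3) qmul_assoc qinv_qmul_self unit_quats_nonzero)
  finally show "n = act_left (fst n \<star> qinv (fst m)) m" by simp
qed

lemma left_reduced_stab:
  "left_reduced lam = orbit_space (stab lam) act_left {m \<in> phase_space. J_left m = lam}"
  by (simp add: left_reduced_def stab_def)

lemma identified_via_left_red_map:
  "identified_via left_red_map (left_reduced lam) (coadjoint_orbit lam)"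
  unfolding left_reduced_stab
proof (rule identified_via_orbit_space)
  fix m n assume mn: "m \<in> {m \<in> phase_space. J_left m = lam}" "n \<in> {m \<in> phase_space. J_left m = lam}"
    "left_red_map m = left_red_map n"
  then obtain l where l: "l \<in> unit_quats" "n = act_left l m" using left_red_map_separates by blast
  then have "l \<in> stab lam" using mn J_left_act_left[OF l(1), of m] by (simp add: stab_def)
  then show "(\<lambda>g. act_left g m) ` stab lam = (\<lambda>g. act_left g n) ` stab lam"
    using stab_orbit_eq[where act = act_left, OF act_left_qmul] l by blast
next
  show "stab lam \<noteq> {}" using one_in_stab by blast
qed (simp_all add: stab_def left_red_map_act_left unit_quats_nonzero left_red_map_image)

lemma left_reduced_classE:
  assumes "c \<in> left_reduced lam"
  obtains m where "m \<in> phase_space" "J_left m = lam" "c = (\<lambda>l. act_left l m) ` stab lam"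
  using assms unfolding left_reduced_stab by (auto elim: orbit_space_classE)

lemma descend_left:
  assumes "\<And>l. l \<in> unit_quats \<Longrightarrow> f (act_left l m) = f m"
  shows "descend f ((\<lambda>l. act_left l m) ` stab lam) = f m"
  using assms one_in_stab[of lam] by (intro descend_eq) (blast, auto simp: stab_def)

text \<open>The left and right actions commute, and the right action preserves the left momentum.
  Hence it acts on left classes, and the reduction map is equivariant.\<close>

lemma act_right_left_reduced:
  assumes "c \<in> left_reduced lam" "r \<in> unit_quats"
  shows "act_right r ` c \<in> left_reduced lam"
    and "descend left_red_map (act_right r ` c) = act_s r (descend left_red_map c)"
proof -
  obtain m where m: "m \<in> phase_space" "J_left m = lam" and c: "c = (\<lambda>l. act_left l m) ` stab lam"
    using left_reduced_classE[OF assms(1)] .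
  have rc: "act_right r ` c = (\<lambda>l. act_left l (act_right r m)) ` stab lam"
    by (simp add: c image_image act_left_right)
  show "act_right r ` c \<in> left_reduced lam"
    using m assms(2) unfolding rc left_reduced_stab orbit_space_def
    by (auto simp: phase_space_act_right J_left_act_right)
  show "descend left_red_map (act_right r ` c) = act_s r (descend left_red_map c)"
    unfolding rc unfolding c using assms(2)
    by (simp add: descend_left left_red_map_act_left left_red_map_act_right unit_quats_nonzero)
qed

lemma descend_J_right:
  assumes "c \<in> left_reduced lam"
  shows "descend J_right c = fst (descend left_red_map c) + fst (snd (descend left_red_map c))"
proof -
  obtain m where "c = (\<lambda>l. act_left l m) ` stab lam" using assms by (rule left_reduced_classE)
  then show ?thesis by (simp add: descend_left J_right_eq left_red_map_act_left unit_quats_nonzero)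
qed

section \<open>The full reduced space as a common level set\<close>

lemma C1_hilbert_map: "C1 (hilbert_map (R1, R2, g)) = (norm g)\<^sup>2"
  unfolding power2_norm_eq_inner by (cases g) (simp add: power2_eq_square)

lemma C2_hilbert_map: "C2 (hilbert_map (R1, R2, g)) = (norm (im R1 \<star> g + g \<star> im R2))\<^sup>2"
  unfolding power2_norm_eq_inner
  by (cases g) (simp add: im_def qmul_def inner_vec_def sum_3 cross3_simps power2_eq_square)

lemma C3_hilbert_map: "C3 (hilbert_map (R1, R2, g)) = (norm (R1 + R2))\<^sup>2"
  unfolding power2_norm_eq_inner
  by (cases g) (simp add: inner_add_left inner_add_right inner_commute)

lemma identified_via_full_reduced:
  "identified_via (hilbert_map \<circ> descend left_red_map) (full_reduced lam rho)
     {y \<in> range hilbert_map. C1 y = 1 \<and> C2 y = (norm lam)\<^sup>2 \<and> C3 y = (norm rho)\<^sup>2}"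
proof -
  let ?X = "{c \<in> left_reduced lam. descend J_right c = rho}"
  have bij: "bij_betw (descend left_red_map) (left_reduced lam) (coadjoint_orbit lam)"
    using identified_via_left_red_map by (simp add: identified_via_def)
  have J_act: "fst (act_s s x) + fst (snd (act_s s x)) = Ad s (fst x + fst (snd x))" for s x
    by (cases x) (simp add: Ad_linear)
  have fr: "full_reduced lam rho = orbit_space (stab rho) (\<lambda>r. (`) (act_right r)) ?X"
    by (simp add: full_reduced_def stab_def)
  show ?thesis unfolding fr
  proof (rule identified_via_orbit_space)
    show "stab rho \<noteq> {}" using one_in_stab by auto
  next
    fix r c assume "r \<in> stab rho" "c \<in> ?X"
    then show "(hilbert_map \<circ> descend left_red_map) (act_right r ` c) = (hilbert_map \<circ> descend left_red_map) c"
      using act_right_left_reduced(2)[of c lam r] by (simp add: stab_def hilbert_map_act_s unit_quats_nonzero)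
  next
    fix c d assume c: "c \<in> ?X" and d: "d \<in> ?X"
      and eq: "(hilbert_map \<circ> descend left_red_map) c = (hilbert_map \<circ> descend left_red_map) d"
    obtain s where s: "s \<in> unit_quats" "descend left_red_map d = act_s s (descend left_red_map c)"
      using eq unfolding comp_apply by (rule hilbert_map_separates)
    \<comment> \<open>The right momentum is equivariant and equals \<open>rho\<close> on both
      classes.\<close>
    have "s \<in> stab rho"
      using s c d descend_J_right[of c lam] descend_J_right[of d lam] J_act by (auto simp: stab_def)
    \<comment> \<open>Both classes have the same image in the coadjoint orbit, where the reduction
      map is injective.\<close>
    moreover have "d = act_right s ` c"
      using s c d act_right_left_reduced[OF _ s(1), of c lam]
      by (intro inj_onD[OF bij_betw_imp_inj_on[OF bij]]) simp_all
    ultimately show "(\<lambda>g. act_right g ` c) ` stab rho = (\<lambda>g. act_right g ` d) ` stab rho"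
      by (intro stab_orbit_eq) (auto simp: act_right_qmul image_image)
  next
    show "(hilbert_map \<circ> descend left_red_map) ` ?X =
      {y \<in> range hilbert_map. C1 y = 1 \<and> C2 y = (norm lam)\<^sup>2 \<and> C3 y = (norm rho)\<^sup>2}" (is "_ = ?Y")
    proof
      show "(hilbert_map \<circ> descend left_red_map) ` ?X \<subseteq> ?Y"
      proof clarsimp
        fix c assume c: "c \<in> left_reduced lam" and rho: "rho = descend J_right c"
        obtain R1 R2 g where D: "descend left_red_map c = (R1, R2, g)" by (metis prod_cases3)
        have "(R1, R2, g) \<in> coadjoint_orbit lam" using bij c by (auto simp: bij_betw_def simp flip: D)
        then show "C1 (hilbert_map (descend left_red_map c)) = 1 \<and>
            C2 (hilbert_map (descend left_red_map c)) = (norm lam)\<^sup>2 \<and>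
            C3 (hilbert_map (descend left_red_map c)) = (norm (descend J_right c))\<^sup>2"
          unfolding descend_J_right[OF c] D C1_hilbert_map C2_hilbert_map C3_hilbert_map
          by (simp add: coadjoint_orbit_def)
      qed
      show "?Y \<subseteq> (hilbert_map \<circ> descend left_red_map) ` ?X"
      proof
        fix y assume y: "y \<in> ?Y"
        then obtain x where yx: "y = hilbert_map x" by blast
        obtain R1 R2 g where x: "x = (R1, R2, g)" by (rule prod_cases3)
        have C: "C1 (hilbert_map (R1, R2, g)) = 1" "C2 (hilbert_map (R1, R2, g)) = (norm lam)\<^sup>2"
          "C3 (hilbert_map (R1, R2, g)) = (norm rho)\<^sup>2"
          using y unfolding yx x by blast+
        then have "x \<in> coadjoint_orbit lam"
          unfolding x C1_hilbert_map C2_hilbert_map by (simp add: coadjoint_orbit_def)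
        then have "x \<in> descend left_red_map ` left_reduced lam"
          using bij by (simp add: bij_betw_def)
        then obtain c where c: "c \<in> left_reduced lam" "descend left_red_map c = x"
          unfolding image_iff by (blast intro: sym)
        have "norm (R1 + R2) = norm rho" using C(3) unfolding C3_hilbert_map by simp
        \<comment> \<open>The level of \<open>C3\<close> fixes only the length of the momentum; a
          right translation turns it into \<open>rho\<close> and leaves the invariants
          unchanged.\<close>
        then obtain s where s: "s \<in> unit_quats" "Ad s (R1 + R2) = rho" by (rule Ad_transitive)
        have "act_right s ` c \<in> ?X"
          using act_right_left_reduced[OF c(1) s(1)] s(2) c(2) x descend_J_right[of "act_right s ` c" lam]
          by (simp add: Ad_linear)
        moreover have "hilbert_map x = (hilbert_map \<circ> descend left_red_map) (act_right s ` c)"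
          unfolding comp_apply act_right_left_reduced(2)[OF c(1) s(1)] c(2)
          by (rule hilbert_map_act_s[OF unit_quats_nonzero[OF s(1)], symmetric])
        ultimately show "y \<in> (hilbert_map \<circ> descend left_red_map) ` ?X" unfolding yx by blast
      qed
    qed
  qed
qed


section \<open>Casimirs\<close>

text \<open>Directional derivatives of polynomials are again polynomials, which drives the induction
  for \<open>C_k\<close>.\<close>

lemma real_polynomial_function_derivative:
  assumes "real_polynomial_function f"
  shows "\<exists>D. (\<forall>x. (f has_derivative D x) (at x)) \<and> (\<forall>v. real_polynomial_function (\<lambda>x. D x v))"
  using assms
proof induction
  case (linear f)
  then show ?case
    by (intro exI[of _ "\<lambda>x. f"]) (auto intro: bounded_linear_imp_has_derivative)
next
  case (const c)
  show ?case by (intro exI[of _ "\<lambda>x h. 0"]) auto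
next
  case (add f g)
  then obtain D E where "\<And>x. (f has_derivative D x) (at x)" "\<And>v. real_polynomial_function (\<lambda>x. D x v)"
    "\<And>x. (g has_derivative E x) (at x)" "\<And>v. real_polynomial_function (\<lambda>x. E x v)" by blast
  then show ?case
    by (intro exI[of _ "\<lambda>x h. D x h + E x h"]) (auto intro: has_derivative_add)
next
  case (mult f g)
  then obtain D E where "\<And>x. (f has_derivative D x) (at x)" "\<And>v. real_polynomial_function (\<lambda>x. D x v)"
    "\<And>x. (g has_derivative E x) (at x)" "\<And>v. real_polynomial_function (\<lambda>x. E x v)" by blast
  with mult.hyps show ?case
    by (intro exI[of _ "\<lambda>x h. f x * E x h + D x h * g x"]) (simp add: has_derivative_mult real_polynomial_function.intros)
qed

lemma C_k_real_polynomial_function: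
  fixes f :: "'a::euclidean_space \<Rightarrow> real"
  assumes "real_polynomial_function f"
  shows "C_k k f"
  using assms
proof (induction k arbitrary: f)
  case 0
  then show ?case by (simp add: continuous_on_polymonial_function real_polynomial_function_eq)
next
  case (Suc k)
  obtain D where D: "\<And>x. (f has_derivative D x) (at x)" "\<And>v. real_polynomial_function (\<lambda>x. D x v)"
    using real_polynomial_function_derivative[OF Suc.prems] by blast
  have "frechet_derivative f (at x) = D x" for x
    using frechet_derivative_at[OF D(1)] by simp
  with D Suc.IH show ?case by (auto simp: differentiable_def)
qed

lemma real_polynomial_function_coordinates:
  "real_polynomial_function (\<lambda>x::sdual. fst x $ i)"
  "real_polynomial_function (\<lambda>x::sdual. fst (snd x) $ i)"
  "real_polynomial_function (\<lambda>x::sdual. fst (snd (snd x)))"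
  "real_polynomial_function (\<lambda>x::sdual. snd (snd (snd x)) $ i)"
  by (auto intro!: real_polynomial_function.intros(1) bounded_linear_intros
      bounded_linear_compose[OF bounded_linear_vec_nth])

lemma hilbert_map_eq:
  "hilbert_map x = (fst x \<bullet> fst x, fst x \<bullet> fst (snd x), fst x \<bullet> snd (snd (snd x)),
     fst (snd x) \<bullet> fst (snd x), fst (snd x) \<bullet> snd (snd (snd x)),
     snd (snd (snd x)) \<bullet> snd (snd (snd x)),
     cross3 (fst x) (fst (snd x)) \<bullet> snd (snd (snd x)), fst (snd (snd x)))"
  by (cases x rule: hilbert_map.cases) simp

lemma smooth_casimirs:
  "smooth (C1 \<circ> hilbert_map)" "smooth (C2 \<circ> hilbert_map)" "smooth (C3 \<circ> hilbert_map)"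
  unfolding smooth_def o_def hilbert_map_eq C1.simps C2.simps C3.simps inner_vec_def sum_3
  by (auto simp: cross3_def intro!: C_k_real_polynomial_function real_polynomial_function_coordinates
      real_polynomial_function.intros(2-4)
      real_polynomial_function_diff real_polynomial_function_power)

section \<open>Gradients and Hamiltonian vector fields\<close>

lemma grad_eq:
  assumes "GDERIV f x :> D"
  shows "grad f x = D"
  unfolding grad_def
proof (rule the_equality)
  fix E assume "GDERIV f x :> E"
  with assms have "(\<lambda>h. h \<bullet> E) = (\<lambda>h. h \<bullet> D)"
    unfolding gderiv_def by (rule has_derivative_unique[rotated])
  then have "\<forall>h. h \<bullet> E = h \<bullet> D" by metis
  then show "E = D" by (simp only: vector_eq_ldot)
qed (fact assms)

text \<open>The Riesz vector of the derivative is its adjoint applied to 1.\<close>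

lemma GDERIV_grad:
  fixes f :: "'a::euclidean_space \<Rightarrow> real"
  assumes "f differentiable (at x)"
  shows "GDERIV f x :> grad f x"
proof -
  obtain f' where f': "(f has_derivative f') (at x)" using assms by (auto simp: differentiable_def)
  have "f' = (\<lambda>h. h \<bullet> adjoint f' 1)"
    using adjoint_works[OF has_derivative_linear[OF f'], of _ 1] by (auto simp: fun_eq_iff)
  then have "GDERIV f x :> adjoint f' 1" using f' unfolding gderiv_def by metis
  with grad_eq show ?thesis by metis
qed

text \<open>The bracket as the derivative of \<open>h\<close> along a vector field depending on
  \<open>f\<close> alone, obtained by moving quaternion factors across the inner product by
  conjugation.\<close>

lemma lie_poisson_eq:
  assumes "GDERIV f (R1, R2, g) :> (f1, f2, f3)"
  shows "lie_poisson f h (R1, R2, g) = grad h (R1, R2, g) \<bullet>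
    (2 *\<^sub>R cross3 R1 f1 - snd (g \<star> qconj f3), 2 *\<^sub>R cross3 R2 f2 + snd (qconj f3 \<star> g),
     g \<star> im f2 - im f1 \<star> g)"
proof -
  obtain h1 h2 h3 where h: "grad h (R1, R2, g) = (h1, h2, h3)" by (metis prod_cases3)
  have comm: "im R \<bullet> (im a \<star> im b - im b \<star> im a) = b \<bullet> (2 *\<^sub>R cross3 R a)" for R a b
    by (simp add: im_def qmul_def inner_vec_def sum_3 cross3_def algebra_simps)
  have "g \<bullet> (im f1 \<star> h3) = - h3 \<bullet> (im f1 \<star> g)" "g \<bullet> (h3 \<star> im f2) = - h3 \<bullet> (g \<star> im f2)"
    using inner_qmul_left[of "im f1" h3 g] inner_qmul_right[of h3 "im f2" g]
    by (simp_all add: inner_commute qconj_im qmul.minus_left qmul.minus_right)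
  moreover have "g \<bullet> (im h1 \<star> f3) = h1 \<bullet> snd (g \<star> qconj f3)" "g \<bullet> (f3 \<star> im h2) = h2 \<bullet> snd (qconj f3 \<star> g)"
    using inner_qmul_right[of "im h1" f3 g] inner_qmul_left[of f3 "im h2" g]
    by (simp_all add: inner_commute) (simp_all add: im_def inner_prod_def)
  ultimately show ?thesis
    unfolding lie_poisson_def grad_eq[OF assms] h prod.case comm
    by (simp add: inner_diff_right inner_add_right)
qed

text \<open>The gradient is 2 g in the last factor only, and g times its conjugate is real, so the
  vector field vanishes.\<close>

lemma lie_poisson_C1: "lie_poisson (C1 \<circ> hilbert_map) h x = 0"
proof -
  obtain R1 R2 g where x: "x = (R1, R2, g)" by (rule prod_cases3)
  have "C1 \<circ> hilbert_map = (\<lambda>x. snd (snd x) \<bullet> snd (snd x))"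
    by (auto simp: fun_eq_iff C1_hilbert_map power2_norm_eq_inner simp del: C1.simps hilbert_map.simps)
  moreover have "GDERIV (\<lambda>x. snd (snd x) \<bullet> snd (snd x)) (R1, R2, g) :> (0, 0, 2 *\<^sub>R g)"
    unfolding gderiv_def
    by (auto intro!: derivative_eq_intros simp: inner_commute)
  ultimately show ?thesis
    unfolding x by (simp add: lie_poisson_eq qconj_scaleR qmul.scaleR_left qmul.scaleR_right
        qmul_qconj qconj_qmul_self im_def qmul.zero_left qmul.zero_right zero_prod_def[symmetric])
qed

lemma snd_commutator:
  "snd (q \<star> im v - im v \<star> q) = 2 *\<^sub>R cross3 (snd q) v"
  "snd (im v \<star> q - q \<star> im v) = 2 *\<^sub>R cross3 v (snd q)"
  by (simp_all add: qmul_def im_def cross_skew[of v "snd q"] scaleR_2)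

lemma im_snd_qmul: "im (snd q) = q - (fst q, 0)"
  by (simp add: im_def prod_eq_iff)

lemma fst_qmul_qconj: "fst (p \<star> qconj q) = p \<bullet> q" "fst (qconj q \<star> p) = p \<bullet> q"
  by (simp_all add: qmul_def qconj_def inner_prod_def inner_commute)

text \<open>All three components of the vector field vanish identically; \<open>q\<close> is the
  value of the quadratic map \<open>Q\<close> at the given point, and \<open>f1\<close>,
  \<open>f2\<close>, \<open>f3\<close> form the gradient of its squared norm.\<close>

lemma lie_poisson_C2: "lie_poisson (C2 \<circ> hilbert_map) h x = 0"
proof -
  obtain R1 R2 g where x: "x = (R1, R2, g)" by (rule prod_cases3)
  define q where "q = im R1 \<star> g + g \<star> im R2"
  define f1 f2 f3 where "f1 = 2 *\<^sub>R snd (q \<star> qconj g)" "f2 = 2 *\<^sub>R snd (qconj g \<star> q)"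
    "f3 = - 2 *\<^sub>R (im R1 \<star> q + q \<star> im R2)"
  note f_defs = this
  define Q :: "sdual \<Rightarrow> quat"
    where "Q = (\<lambda>x. im (fst x) \<star> snd (snd x) + snd (snd x) \<star> im (fst (snd x)))"
  have C2: "C2 \<circ> hilbert_map = (\<lambda>x. Q x \<bullet> Q x)"
    by (auto simp: Q_def fun_eq_iff C2_hilbert_map power2_norm_eq_inner simp del: C2.simps hilbert_map.simps)
  have dQ: "(Q has_derivative (\<lambda>d. im (fst d) \<star> g + im R1 \<star> snd (snd d) + snd (snd d) \<star> im R2 + g \<star> im (fst (snd d)))) (at (R1, R2, g))"
    unfolding Q_def
    by (auto intro!: derivative_eq_intros qmul.FDERIV bounded_linear.has_derivative[OF bounded_linear_im])
  have "((\<lambda>x. Q x \<bullet> Q x) has_derivative (\<lambda>d. 2 * ((im (fst d) \<star> g + im R1 \<star> snd (snd d) + snd (snd d) \<star> im R2 + g \<star> im (fst (snd d))) \<bullet> q))) (at (R1, R2, g))"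
    using has_derivative_inner[OF dQ dQ] by (simp add: Q_def q_def inner_commute)
  moreover have "2 * ((im a \<star> g + im R1 \<star> c + c \<star> im R2 + g \<star> im b) \<bullet> q) = (a, b, c) \<bullet> (f1, f2, f3)" for a b c
  proof -
    have "(im a \<star> g) \<bullet> q = a \<bullet> snd (q \<star> qconj g)" "(g \<star> im b) \<bullet> q = b \<bullet> snd (qconj g \<star> q)"
      by (simp_all add: inner_qmul_right[of "im a"] inner_qmul_left[of _ "im b"]) (simp_all add: im_def inner_prod_def)
    moreover have "(im R1 \<star> c) \<bullet> q = - c \<bullet> (im R1 \<star> q)" "(c \<star> im R2) \<bullet> q = - c \<bullet> (q \<star> im R2)"
      by (simp_all add: inner_qmul_left[of "im R1"] inner_qmul_right[of _ "im R2"] qconj_im qmul.minus_left qmul.minus_right)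
    ultimately show ?thesis
      by (simp add: f_defs inner_add_left inner_add_right algebra_simps)
  qed
  ultimately have G: "GDERIV (C2 \<circ> hilbert_map) (R1, R2, g) :> (f1, f2, f3)"
    unfolding gderiv_def C2 by (simp add: case_prod_unfold)
  \<comment> \<open>Solving the definition of \<open>q\<close> for one summand turns the products
    with \<open>f3\<close> into commutators plus a real term.\<close>
  have "g \<star> im R2 = q - im R1 \<star> g" "im R1 \<star> g = q - g \<star> im R2" by (simp_all add: q_def)
  note gR = this
  have cf3: "qconj f3 = 2 *\<^sub>R (qconj q \<star> im R1 + im R2 \<star> qconj q)"
    unfolding f_defs qconj_scaleR qconj_add qconj_qmul qconj_im qmul.minus_left qmul.minus_right
    by (simp add: scaleR_right_distrib scaleR_right_diff_distrib)
  define p r where "p = q \<star> qconj g" and "r = qconj g \<star> q"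
  have p: "g \<star> qconj q = qconj p" and r: "qconj q \<star> g = qconj r" by (simp_all add: p_def r_def qconj_qmul)
  have "g \<star> qconj f3 = 2 *\<^sub>R (qconj p \<star> im R1 - im R1 \<star> qconj p + ((norm q)\<^sup>2, 0))"
    by (simp add: cf3 qmul.scaleR_right qmul.add_right gR(1) qmul.diff_left qmul_qconj flip: qmul_assoc p)
  then have 1: "snd (g \<star> qconj f3) = 2 *\<^sub>R cross3 R1 f1"
    using snd_commutator(1)[of "qconj p" R1]
    by (simp add: f_defs flip: p_def) (simp add: qconj_def cross_skew[of "snd p"] Cross3.cross_minus_left cross_mult_right)
  have "qconj f3 \<star> g = 2 *\<^sub>R (im R2 \<star> qconj r - qconj r \<star> im R2 + ((norm q)\<^sup>2, 0))"
    by (simp add: cf3 qmul.scaleR_left qmul.add_left qmul_assoc gR(2) qmul.diff_right qconj_qmul_self flip: r)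
  then have 2: "snd (qconj f3 \<star> g) = - 2 *\<^sub>R cross3 R2 f2"
    using snd_commutator(2)[of R2 "qconj r"]
    by (simp add: f_defs flip: r_def) (simp add: qconj_def cross_skew[of "snd r"] Cross3.cross_minus_left cross_mult_right)
  \<comment> \<open>Removing the real part of q times the conjugate of g subtracts the inner product
    of \<open>q\<close> and \<open>g\<close>; the same happens on the other side, so the two
    products agree.\<close>
  have "im f1 \<star> g = 2 *\<^sub>R ((norm g)\<^sup>2 *\<^sub>R q - (q \<bullet> g) *\<^sub>R g)"
    by (simp add: f_defs im_scaleR im_snd_qmul fst_qmul_qconj qmul.scaleR_left qmul.diff_left qmul_real_left
        qmul_real_right qmul_assoc qconj_qmul_self)
  moreover have "g \<star> im f2 = 2 *\<^sub>R ((norm g)\<^sup>2 *\<^sub>R q - (q \<bullet> g) *\<^sub>R g)"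
    by (simp add: f_defs im_scaleR im_snd_qmul fst_qmul_qconj qmul.scaleR_right qmul.diff_right qmul_real_left
        qmul_real_right qmul_qconj flip: qmul_assoc)
  ultimately show ?thesis
    unfolding x lie_poisson_eq[OF G] by (simp add: 1 2 zero_prod_def[symmetric])
qed

text \<open>Differentiates the constancy of \<open>f\<close> along a curve in the orbit; the second
  argument of the inner product is the infinitesimal generator of the action in direction
  \<open>u\<close>.\<close>

lemma invariant_infinitesimal:
  assumes "f differentiable (at (R1, R2, g))" and inv: "invariant f"
  shows "grad f (R1, R2, g) \<bullet> (2 *\<^sub>R cross3 u R1, 2 *\<^sub>R cross3 u R2, im u \<star> g - g \<star> im u) = 0"
proof -
  \<comment> \<open>The curve 1 + t u is not of unit length, but conjugation ignores scale, and the
    resulting orbit curve is rational in \<open>t\<close>.\<close>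
  define s where "s = (\<lambda>t::real. (1::real, t *\<^sub>R u))"
  have s: "s t \<noteq> 0" for t by (simp add: s_def zero_prod_def)
  have conj: "((\<lambda>t. s t \<star> w \<star> qinv (s t)) has_derivative (\<lambda>t. t *\<^sub>R (im u \<star> w - w \<star> im u))) (at 0)" for w
  proof -
    have "(norm (s t))\<^sup>2 = 1 + t\<^sup>2 * (u \<bullet> u)" for t
      unfolding power2_norm_eq_inner by (simp add: s_def power2_eq_square)
    moreover have "s t \<star> w \<star> qconj (s t) = w + t *\<^sub>R (im u \<star> w - w \<star> im u) - t\<^sup>2 *\<^sub>R (im u \<star> w \<star> im u)" for t
    proof -
      have "s t = (1, 0) + t *\<^sub>R im u" "qconj (s t) = (1, 0) - t *\<^sub>R im u"
        by (simp_all add: s_def qconj_def im_def)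
      then have "s t \<star> w \<star> qconj (s t) = ((1, 0) + t *\<^sub>R im u) \<star> w \<star> ((1, 0) - t *\<^sub>R im u)"
        by (simp only:)
      then show ?thesis
        by (simp add: qmul.scaleR_right qmul.scaleR_left qmul.add_left qmul.diff_right
            power2_eq_square algebra_simps)
    qed
    ultimately have "s t \<star> w \<star> qinv (s t) =
        (1 / (1 + t\<^sup>2 * (u \<bullet> u))) *\<^sub>R (w + t *\<^sub>R (im u \<star> w - w \<star> im u) - t\<^sup>2 *\<^sub>R (im u \<star> w \<star> im u))" for t
      by (simp add: qinv_def qmul.scaleR_right)
    then show ?thesis
      by (auto intro!: derivative_eq_intros)
  qed
  define c where "c = (\<lambda>t. act_s (s t) (R1, R2, g))"
  have Ad': "((\<lambda>t. Ad (s t) v) has_derivative (\<lambda>t. t *\<^sub>R (2 *\<^sub>R cross3 u v))) (at 0)" for v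
    using has_derivative_snd[OF conj[of "im v"]] cross_skew[of v u]
    by (simp add: Ad_def im_def qmul_def scaleR_2)
  have c: "(c has_derivative (\<lambda>t. t *\<^sub>R (2 *\<^sub>R cross3 u R1, 2 *\<^sub>R cross3 u R2, im u \<star> g - g \<star> im u))) (at 0)"
    using has_derivative_Pair[OF Ad'[of R1] has_derivative_Pair[OF Ad'[of R2] conj[of g]]]
    by (simp add: c_def)
  have c0: "c 0 = (R1, R2, g)"
    by (simp add: c_def s_def qinv_def qconj_def)
  \<comment> \<open>Normalising \<open>s t\<close> gives a unit quaternion with the same action, so
    invariance applies.\<close>
  have fc: "f (c t) = f (R1, R2, g)" for t
  proof -
    obtain l where l: "l \<in> unit_quats" "Ad l = Ad (s t)" using ex_unit_Ad[OF s] .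
    have "c t = act_s l (R1, R2, g)"
      using l qmul_real_conj[OF s] qmul_real_conj[OF unit_quats_nonzero[OF l(1)]] by (simp add: c_def)
    then show ?thesis using inv l(1) unfolding invariant_def by (simp only:)
  qed
  have "(f has_derivative (\<lambda>h. h \<bullet> grad f (R1, R2, g))) (at (c 0))"
    using GDERIV_grad[OF assms(1)] by (simp add: c0 gderiv_def)
  from has_derivative_compose[OF c this]
  have "((\<lambda>t. f (R1, R2, g)) has_derivative
      (\<lambda>t. t *\<^sub>R (2 *\<^sub>R cross3 u R1, 2 *\<^sub>R cross3 u R2, im u \<star> g - g \<star> im u) \<bullet> grad f (R1, R2, g))) (at 0)"
    by (simp only: fc)
  from fun_cong[OF has_derivative_unique[OF this has_derivative_const], of 1]
  show ?thesis by (simp only: inner_commute scaleR_one)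
qed

text \<open>The Hamiltonian vector field is -2 times the infinitesimal generator for u = R1 + R2,
  along which invariant functions have zero derivative.\<close>

lemma lie_poisson_C3:
  assumes "h differentiable (at x)" "invariant h"
  shows "lie_poisson (C3 \<circ> hilbert_map) h x = 0"
proof -
  obtain R1 R2 g where x: "x = (R1, R2, g)" by (rule prod_cases3)
  define u where "u = R1 + R2"
  have C3: "C3 \<circ> hilbert_map = (\<lambda>x. (fst x + fst (snd x)) \<bullet> (fst x + fst (snd x)))"
    by (auto simp: fun_eq_iff C3_hilbert_map power2_norm_eq_inner simp del: C3.simps hilbert_map.simps)
  have G: "GDERIV (C3 \<circ> hilbert_map) (R1, R2, g) :> (2 *\<^sub>R u, 2 *\<^sub>R u, 0)"
    unfolding gderiv_def C3
    by (auto intro!: derivative_eq_intros simp: u_def inner_commute algebra_simps fun_eq_iff inner_add_left inner_add_right)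
  have "lie_poisson (C3 \<circ> hilbert_map) h x =
     grad h (R1, R2, g) \<bullet> (- 2 *\<^sub>R (2 *\<^sub>R cross3 u R1, 2 *\<^sub>R cross3 u R2, im u \<star> g - g \<star> im u))"
    unfolding x lie_poisson_eq[OF G]
    by (simp add: cross_skew[of _ u] im_scaleR qmul.scaleR_left qmul.scaleR_right qconj_def
        cross_mult_right scaleR_diff_right qmul.zero_left qmul.zero_right zero_prod_def[symmetric])
  also have "\<dots> = 0"
    using invariant_infinitesimal[of h R1 R2 g u] assms by (simp only: x inner_scaleR_right mult_zero_right)
  finally show ?thesis .
qed

lemma casimirs:
  "casimir_on_quotient C1" "casimir_on_quotient C2" "casimir_on_quotient C3"
proof -
  have "invariant (C \<circ> hilbert_map)" for C :: "coords \<Rightarrow> real"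
    by (simp add: invariant_def hilbert_map_act_s unit_quats_nonzero)
  moreover have "f differentiable (at x)" if "smooth f" for f :: "sdual \<Rightarrow> real" and x
    using that unfolding smooth_def by (metis C_k.simps(2))
  ultimately show "casimir_on_quotient C1" "casimir_on_quotient C2" "casimir_on_quotient C3"
    unfolding casimir_on_quotient_def
    by (simp_all add: smooth_casimirs lie_poisson_C1 lie_poisson_C2 lie_poisson_C3)
qed


theorem theorem2p4:
  shows "identified_via hilbert_map (orbit_space unit_quats act_s UNIV) (range hilbert_map) \<and>
    range hilbert_map = reduced_variety \<and>
    casimir_on_quotient C1 \<and> casimir_on_quotient C2 \<and> casimir_on_quotient C3 \<and>
    (\<forall>lam rho :: real^3.
      identified_via left_red_map (left_reduced lam) (coadjoint_orbit lam) \<and>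
      identified_via (hilbert_map \<circ> descend left_red_map) (full_reduced lam rho)
        {y \<in> reduced_variety. C1 y = 1 \<and> C2 y = (norm lam)\<^sup>2 \<and> C3 y = (norm rho)\<^sup>2})"
  using identified_via_hilbert_map range_hilbert_map casimirs identified_via_left_red_map
    identified_via_full_reduced by (simp only: simp_thms range_hilbert_map)

end
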